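(* If $n$ is a prime power, i.e. $n=p^m$ with $p$ prime and $m\ge 1$, then the domination polynomial $D(\Gamma(\mathbb{Z}_n),x)$ of the co-maximal graph of $\mathbb{Z}_n$ is log-concave and unimodal.
   Context: All graphs are finite, simple and undirected. The co-maximal graph $\Gamma(\mathbb{Z}_n)$ has vertex set $\mathbb{Z}_n$, and two distinct elements $a,b$ are adjacent if and only if $a\mathbb{Z}_n+b\mathbb{Z}_n=\mathbb{Z}_n$. A dominating set of a graph $G$ is a non-empty set $S\subseteq V(G)$ such that every vertex of $V(G)\setminus S$ is adjacent to at least one vertex of $S$. The domination polynomial of $G$ is $D(G,x)=\sum_{k} D(G,k)x^k$, where $D(G,k)$ is the number of dominating sets of $G$ of cardinality $k$. A polynomial $e(x)=\sum_{i=0}^{N}e_ix^i$ of degree $N$ is unimodal if there is an index $\ell$ with $e_0\le e_1\le\cdots\le e_\ell\ge e_{\ell+1}\ge\cdots\ge e_N$, and log-concave if $e_i^2\ge e_{i-1}e_{i+1}$ for all $1\le i\le N-1$. *)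

theory Defs
  imports
    "HOL-Number_Theory.Residues"
    "HOL-Computational_Algebra.Polynomial"
    "Graph_Theory.Pair_Digraph"
begin

text \<open>
  A finite simple undirected graph is modelled as a finite loop-free symmetric digraph without
  parallel arcs (\<^locale>\<open>pair_graph\<close>); an edge \<open>{a, b}\<close> is the pair of arcs \<open>(a, b)\<close>, \<open>(b, a)\<close>.
\<close>

definition comaximal_graph :: "('a, 'm) ring_scheme \<Rightarrow> 'a pair_pre_digraph" where
  "comaximal_graph R =
    \<lparr> pverts = carrier R,
      parcs = {(a, b). a \<in> carrier R \<and> b \<in> carrier R \<and> a \<noteq> b \<and>
                 (PIdl\<^bsub>R\<^esub> a) <+>\<^bsub>R\<^esub> (PIdl\<^bsub>R\<^esub> b) = carrier R} \<rparr>"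

lemma (in cring) pair_graph_comaximal_graph:
  assumes fin: "finite (carrier R)"
  shows "pair_graph (comaximal_graph R)"
proof -
  have comm: "(PIdl b) <+>\<^bsub>R\<^esub> (PIdl a) = (PIdl a) <+>\<^bsub>R\<^esub> (PIdl b)"
    if "a \<in> carrier R" "b \<in> carrier R" for a b
    by (rule set_add_comm)
       (use that in \<open>auto simp: cgenideal_def\<close>)
  let ?G = "comaximal_graph R"
  have verts: "pverts ?G = carrier R"
    by (simp add: comaximal_graph_def)
  have sub: "parcs ?G \<subseteq> carrier R \<times> carrier R"
    unfolding comaximal_graph_def pair_pre_digraph.simps by blast
  have loopfree: "fst e \<noteq> snd e" if "e \<in> parcs ?G" for e
    using that unfolding comaximal_graph_def pair_pre_digraph.simps by fastforce
  have fin_arcs: "finite (parcs ?G)"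
    using sub fin by (meson finite_SigmaI finite_subset)
  have sym: "(b, a) \<in> parcs ?G" if "(a, b) \<in> parcs ?G" for a b
    using that comm unfolding comaximal_graph_def pair_pre_digraph.simps
      mem_Collect_eq prod.case by metis
  show ?thesis
  proof unfold_locales
    show "fst e \<in> pverts ?G" "snd e \<in> pverts ?G" if "e \<in> parcs ?G" for e
      using that sub unfolding verts by auto
    show "finite (pverts ?G)" unfolding verts by (rule fin)
    show "symmetric (with_proj ?G)"
      unfolding symmetric_def with_proj_simps by (rule symI) (rule sym)
  qed (fact fin_arcs loopfree)+
qed

lemma pair_graph_comaximal_graph_residue_ring:
  assumes "n > 1"
  shows "pair_graph (comaximal_graph (residue_ring n))"
proof -
  from assms have "residues n" by (simp add: residues_def)
  then have "cring (residue_ring n)" by (rule residues.cring)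
  moreover have "finite (carrier (residue_ring n))" by (simp add: residue_ring_def)
  ultimately show ?thesis by (rule cring.pair_graph_comaximal_graph)
qed

definition dominating_set :: "'a pair_pre_digraph \<Rightarrow> 'a set \<Rightarrow> bool" where
  "dominating_set G S \<longleftrightarrow>
    S \<noteq> {} \<and> S \<subseteq> pverts G \<and> (\<forall>v \<in> pverts G - S. \<exists>u \<in> S. (v, u) \<in> parcs G)"

definition domination_poly :: "'a pair_pre_digraph \<Rightarrow> int poly" where
  "domination_poly G =
    (\<Sum>k \<le> card (pverts G). monom (int (card {S. dominating_set G S \<and> card S = k})) k)"

definition unimodal_poly :: "'a :: linordered_idom poly \<Rightarrow> bool" where
  "unimodal_poly e \<longleftrightarrow>
    (\<exists>l \<le> degree e.
       (\<forall>i < l. coeff e i \<le> coeff e (i + 1)) \<and>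
       (\<forall>i. l \<le> i \<and> i < degree e \<longrightarrow> coeff e i \<ge> coeff e (i + 1)))"

definition log_concave_poly :: "'a :: linordered_idom poly \<Rightarrow> bool" where
  "log_concave_poly e \<longleftrightarrow>
    (\<forall>i. 1 \<le> i \<and> i < degree e \<longrightarrow> (coeff e i)\<^sup>2 \<ge> coeff e (i - 1) * coeff e (i + 1))"

end

theory Submission
  imports Defs
begin

text \<open>
  Let \<open>q = p ^ (m - 1)\<close>, the number of non-units of \<open>\<int>/n\<close>. This ring is local: a unit is
  co-maximal with every other element, whereas any two non-units lie in the proper ideal generated
  by \<open>p\<close>. Hence a set of vertices that contains a unit dominates, and a set of non-units dominates
  only if it is the set of all of them, because distinct non-units are not adjacent. The sets that
  fail to dominate are therefore exactly the proper subsets of the set of \<open>q\<close> non-units, and the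
  domination polynomial is \<open>(1 + x) ^ n - ((1 + x) ^ q - x ^ q)\<close>.

  Log-concavity follows because the subtracted part is relatively small. Write \<open>a k\<close> for
  \<open>n choose k\<close> and \<open>e k\<close> for the number of proper \<open>k\<close>-subsets of a \<open>q\<close>-set. As \<open>n = p q \<ge> 2 q\<close>,
  the quotient \<open>e k / a k\<close> is nonincreasing in \<open>k\<close> and at most \<open>1 / (k + 1)\<close>; these are
  \<open>binomial_ratio_antimono\<close> and \<open>Suc_times_binomial_le\<close>. On the other hand the binomial
  coefficients satisfy a strengthened log-concavity,
  \<open>a (k - 1) * a (k + 1) \<le> k / (k + 1) * (a k)\<^sup>2\<close>, and
  the slack \<open>k / (k + 1)\<close> is just what the bound on \<open>e k / a k\<close> uses up
  (\<open>log_concave_minus_small\<close>). The same bound shows that all coefficients of positive index up to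
  the degree are positive, so that unimodality follows from log-concavity.
\<close>

section \<open>Unimodality from log-concavity\<close>

text \<open>
  Log-concavity makes a strict descent persist: if \<open>e\<^sub>i > e\<^sub>i\<^sub>+\<^sub>1\<close>, then
  \<open>e\<^sub>i\<^sub>+\<^sub>1\<^sup>2 \<ge> e\<^sub>i e\<^sub>i\<^sub>+\<^sub>2\<close> forces \<open>e\<^sub>i\<^sub>+\<^sub>1 > e\<^sub>i\<^sub>+\<^sub>2\<close>, provided \<open>e\<^sub>i\<^sub>+\<^sub>1 \<noteq> 0\<close>. The peak is thus the first
  index followed by a strict descent. The last hypothesis says that there are no internal zeros; it
  allows zeros at the low end.
\<close>

lemma unimodal_poly_if_log_concave_poly:
  fixes e :: "'a :: linordered_idom poly"
  assumes lc: "log_concave_poly e"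
    and nonneg: "\<And>i. coeff e i \<ge> 0"
    and pos: "\<And>i j. \<lbrakk>i \<le> j; j \<le> degree e; coeff e i > 0\<rbrakk> \<Longrightarrow> coeff e j > 0"
  shows "unimodal_poly e"
proof -
  define P where "P l \<longleftrightarrow> l = degree e \<or> coeff e (l + 1) < coeff e l" for l
  define l where "l = (LEAST l. P l)"
  have "P (degree e)" by (simp add: P_def)
  then have Pl: "P l" and l_le: "l \<le> degree e"
    unfolding l_def by (auto intro: LeastI Least_le)
  have up: "coeff e i \<le> coeff e (i + 1)" if "i < l" for i
    using not_less_Least[of i P] that by (auto simp: l_def P_def)
  have down: "coeff e (i + 1) < coeff e i" if "l \<le> i" "i < degree e" for i
    using that
  proof (induction i rule: dec_induct)
    case base
    then show ?case using Pl by (simp add: P_def)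
  next
    case (step i)
    then have desc: "coeff e (i + 1) < coeff e i" by simp
    have pos': "coeff e (i + 1) > 0"
      using pos[of i "i + 1"] nonneg[of "i + 1"] desc step.prems by auto
    have lc': "coeff e i * coeff e (i + 2) \<le> coeff e (i + 1) * coeff e (i + 1)"
      using lc step.prems unfolding log_concave_poly_def
      by (auto simp: power2_eq_square dest!: spec[of _ "i + 1"])
    have "\<not> coeff e (i + 1) \<le> coeff e (i + 2)"
    proof
      assume "coeff e (i + 1) \<le> coeff e (i + 2)"
      then have "coeff e i * coeff e (i + 1) \<le> coeff e i * coeff e (i + 2)"
        using nonneg by (rule mult_left_mono)
      moreover have "coeff e (i + 1) * coeff e (i + 1) < coeff e i * coeff e (i + 1)"
        using desc pos' by (rule mult_strict_right_mono)
      ultimately show False using lc' by simp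
    qed
    then show ?case by simp
  qed
  show ?thesis
    unfolding unimodal_poly_def using l_le up down by (blast intro: less_imp_le)
qed

section \<open>Inequalities for binomial coefficients\<close>

text \<open>
  The common source of the estimates below: consecutive binomial coefficients have the quotient
  \<open>(n - k) / (k + 1)\<close>.
\<close>

lemma Suc_times_binomial_Suc: "Suc k * (n choose Suc k) = (n - k) * (n choose k)"
proof (cases n)
  case (Suc n')
  then show ?thesis
    using Suc_times_binomial[of k n'] binomial_absorb_comp[of n k] by simp
qed simp

text \<open>
  Each step from \<open>k\<close> to \<open>k + 1\<close> multiplies the quotient of the two binomial coefficients by
  \<open>(q - k) / (n - k) \<le> 1 / 2\<close>.
\<close>

lemma power2_times_binomial_le:
  assumes "2 * q \<le> n"
  shows "2 ^ k * (q choose k) \<le> n choose k"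
proof (induction k)
  case (Suc k)
  have "Suc k * (2 ^ Suc k * (q choose Suc k)) = 2 ^ Suc k * (Suc k * (q choose Suc k))"
    by (simp only: mult_ac)
  also have "\<dots> = (2 * (q - k)) * (2 ^ k * (q choose k))"
    by (simp only: Suc_times_binomial_Suc power_Suc mult_ac)
  also have "\<dots> \<le> (n - k) * (n choose k)"
    using assms Suc.IH by (intro mult_mono) auto
  also have "\<dots> = Suc k * (n choose Suc k)"
    by (simp only: Suc_times_binomial_Suc)
  finally show ?case by (simp only: Suc_mult_le_cancel1)
qed simp

lemma Suc_times_binomial_le:
  assumes "2 * q \<le> n"
  shows "Suc k * (q choose k) \<le> n choose k"
proof -
  have "Suc k \<le> 2 ^ k" using less_exp by (rule Suc_leI)
  then have "Suc k * (q choose k) \<le> 2 ^ k * (q choose k)" by (rule mult_right_mono) simp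
  also have "\<dots> \<le> n choose k" by (rule power2_times_binomial_le[OF assms])
  finally show ?thesis .
qed

lemma binomial_ratio_antimono:
  assumes "q \<le> n"
  shows "(q choose Suc k) * (n choose k) \<le> (q choose k) * (n choose Suc k)"
proof -
  have "Suc k * ((q choose Suc k) * (n choose k)) = (q - k) * ((q choose k) * (n choose k))"
    using Suc_times_binomial_Suc[of k q] by (metis mult.assoc)
  also have "\<dots> \<le> (n - k) * ((q choose k) * (n choose k))"
    using assms by (intro mult_right_mono) auto
  also have "\<dots> = Suc k * ((q choose k) * (n choose Suc k))"
    using Suc_times_binomial_Suc[of k n] by (metis mult.assoc mult.commute)
  finally show ?thesis by (simp only: Suc_mult_le_cancel1)
qed

lemma binomial_strong_log_concave:
  "(k + 2) * ((n choose k) * (n choose (k + 2))) \<le> (k + 1) * (n choose (k + 1))\<^sup>2"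
proof -
  have "(k + 2) * ((n choose k) * (n choose (k + 2)))
      = (n choose k) * ((n - (k + 1)) * (n choose (k + 1)))"
    using Suc_times_binomial_Suc[of "k + 1" n] by (simp add: mult_ac)
  also have "\<dots> \<le> (n - k) * (n choose k) * (n choose (k + 1))"
    by (simp add: mult.left_commute[of "n choose k"] mult.assoc mult_right_mono diff_le_mono2)
  also have "\<dots> = (k + 1) * (n choose (k + 1))\<^sup>2"
    by (simp add: power2_eq_square flip: Suc_times_binomial_Suc mult.assoc)
  finally show ?thesis .
qed

text \<open>
  Multiplying the goal by \<open>a\<^sub>1\<close>, the antitone quotients turn \<open>(a\<^sub>0 - e\<^sub>0) * a\<^sub>1\<close> into
  \<open>a\<^sub>0 * (a\<^sub>1 - e\<^sub>1)\<close>, and dropping \<open>e\<^sub>2\<close> leaves \<open>a\<^sub>0 * a\<^sub>2 \<le> (a\<^sub>1 - e\<^sub>1) * a\<^sub>1\<close>. With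
  \<open>e\<^sub>1 \<le> a\<^sub>1 / c\<close> this is the strong log-concavity of \<open>a\<close> with constant \<open>(c - 1) / c\<close>.
\<close>

lemma log_concave_minus_small:
  fixes a\<^sub>0 a\<^sub>1 a\<^sub>2 e\<^sub>0 e\<^sub>1 e\<^sub>2 c :: int
  assumes nonneg: "0 \<le> a\<^sub>0" "0 \<le> a\<^sub>2" "0 \<le> e\<^sub>2"
    and pos: "0 < a\<^sub>1" "0 < c"
    and le: "e\<^sub>0 \<le> a\<^sub>0" "e\<^sub>1 \<le> a\<^sub>1"
    and ratio: "e\<^sub>1 * a\<^sub>0 \<le> e\<^sub>0 * a\<^sub>1"
    and small: "c * e\<^sub>1 \<le> a\<^sub>1"
    and strong: "c * (a\<^sub>0 * a\<^sub>2) \<le> (c - 1) * a\<^sub>1\<^sup>2"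
  shows "(a\<^sub>0 - e\<^sub>0) * (a\<^sub>2 - e\<^sub>2) \<le> (a\<^sub>1 - e\<^sub>1)\<^sup>2"
proof -
  have "(c - 1) * a\<^sub>1 \<le> c * (a\<^sub>1 - e\<^sub>1)"
    using small by (simp add: algebra_simps)
  then have "(c - 1) * a\<^sub>1 * a\<^sub>1 \<le> c * (a\<^sub>1 - e\<^sub>1) * a\<^sub>1"
    using pos by (intro mult_right_mono) auto
  with strong have "c * (a\<^sub>0 * a\<^sub>2) \<le> c * ((a\<^sub>1 - e\<^sub>1) * a\<^sub>1)"
    by (simp add: power2_eq_square mult.assoc)
  then have key: "a\<^sub>0 * a\<^sub>2 \<le> (a\<^sub>1 - e\<^sub>1) * a\<^sub>1"
    using pos by simp
  have "(a\<^sub>0 - e\<^sub>0) * (a\<^sub>2 - e\<^sub>2) * a\<^sub>1 \<le> (a\<^sub>0 - e\<^sub>0) * a\<^sub>2 * a\<^sub>1"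
    using nonneg pos le by (intro mult_right_mono mult_left_mono) auto
  also have "\<dots> = ((a\<^sub>0 - e\<^sub>0) * a\<^sub>1) * a\<^sub>2" by simp
  also have "\<dots> \<le> (a\<^sub>0 * (a\<^sub>1 - e\<^sub>1)) * a\<^sub>2"
    using ratio nonneg by (intro mult_right_mono) (auto simp: algebra_simps)
  also have "\<dots> = (a\<^sub>1 - e\<^sub>1) * (a\<^sub>0 * a\<^sub>2)" by simp
  also have "\<dots> \<le> (a\<^sub>1 - e\<^sub>1) * ((a\<^sub>1 - e\<^sub>1) * a\<^sub>1)"
    using key le by (intro mult_left_mono) auto
  also have "\<dots> = (a\<^sub>1 - e\<^sub>1)\<^sup>2 * a\<^sub>1" by (simp add: power2_eq_square)
  finally show ?thesis using pos by simp
qed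

section \<open>Domination polynomials of complete split graphs\<close>

text \<open>The coefficient of \<open>x ^ k\<close> in \<open>(1 + x) ^ q - x ^ q\<close>.\<close>

definition proper_choose :: "nat \<Rightarrow> nat \<Rightarrow> nat" where
  "proper_choose q k = (if k < q then q choose k else 0)"

lemma card_psubsets:
  assumes "finite A"
  shows "card {B. B \<subset> A \<and> card B = k} = proper_choose (card A) k"
proof (cases "k < card A")
  case True
  then have "{B. B \<subset> A \<and> card B = k} = {B. B \<subseteq> A \<and> card B = k}" by auto
  then show ?thesis using True assms by (simp add: proper_choose_def n_subsets)
next
  case False
  then have none: "{B. B \<subset> A \<and> card B = k} = {}"
    using assms by (auto dest: psubset_card_mono)
  show ?thesis unfolding none using False by (simp add: proper_choose_def)
qed

text \<open>
  The independent part \<open>N\<close> has to be nonempty, so that the empty set, which does not dominate, is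
  one of its proper subsets.
\<close>

locale complete_split_graph =
  fixes G :: "'a pair_pre_digraph" and N :: "'a set"
  assumes finite_verts: "finite (pverts G)"
    and indep_subset: "N \<subseteq> pverts G"
    and indep_nonempty: "N \<noteq> {}"
    and arcs_iff: "\<And>a b. (a, b) \<in> parcs G \<longleftrightarrow>
      a \<in> pverts G \<and> b \<in> pverts G \<and> a \<noteq> b \<and> \<not> (a \<in> N \<and> b \<in> N)"
begin

lemma dominating_set_iff:
  "dominating_set G S \<longleftrightarrow> S \<subseteq> pverts G \<and> \<not> S \<subset> N"
proof (cases "S \<subseteq> N")
  case True
  then show ?thesis
    using indep_subset indep_nonempty unfolding dominating_set_def by (auto simp: arcs_iff)
next
  case False
  then obtain u where "u \<in> S" "u \<notin> N" by blast
  then have "\<exists>u \<in> S. (v, u) \<in> parcs G" if "S \<subseteq> pverts G" "v \<in> pverts G - S" for v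
    using that by (auto simp: arcs_iff)
  then show ?thesis
    using False \<open>u \<in> S\<close> unfolding dominating_set_def by blast
qed

lemma card_dominating_sets:
  "int (card {S. dominating_set G S \<and> card S = k})
     = int (card (pverts G) choose k) - int (proper_choose (card N) k)"
proof -
  let ?A = "{S. S \<subseteq> pverts G \<and> card S = k}" and ?B = "{S. S \<subset> N \<and> card S = k}"
  have "finite ?A" using finite_verts by simp
  moreover have "?B \<subseteq> ?A" using indep_subset by auto
  moreover have "{S. dominating_set G S \<and> card S = k} = ?A - ?B"
    by (auto simp: dominating_set_iff)
  moreover have "finite N" using finite_verts indep_subset by (rule finite_subset[rotated])
  ultimately show ?thesis
    using finite_verts
    by (simp add: card_Diff_subset finite_subset card_mono of_nat_diff
        flip: n_subsets card_psubsets)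
qed

lemma coeff_domination_poly:
  "coeff (domination_poly G) k
     = int (card (pverts G) choose k) - int (proper_choose (card N) k)"
proof (cases "k \<le> card (pverts G)")
  case True
  then show ?thesis
    by (simp add: domination_poly_def coeff_sum sum.delta card_dominating_sets)
next
  case False
  have "card N \<le> card (pverts G)" using finite_verts indep_subset by (rule card_mono)
  then show ?thesis
    using False by (simp add: domination_poly_def coeff_sum sum.delta proper_choose_def)
qed

end

text \<open>
  The bound on the independent part is what makes the number of non-dominating \<open>k\<close>-sets at most
  \<open>1 / (k + 1)\<close> of the number of all \<open>k\<close>-sets.
\<close>

locale small_complete_split_graph = complete_split_graph +
  assumes small: "2 * card N \<le> card (pverts G)"
begin

lemma card_indep_less: "card N < card (pverts G)"
proof -
  have "finite N" using finite_verts indep_subset by (rule finite_subset[rotated])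
  then have "0 < card N" using indep_nonempty by (simp add: card_gt_0_iff)
  then show ?thesis using small by linarith
qed

lemma degree_domination_poly: "degree (domination_poly G) = card (pverts G)"
proof (rule antisym)
  show "degree (domination_poly G) \<le> card (pverts G)"
    using card_indep_less
    by (intro degree_le) (auto simp: coeff_domination_poly proper_choose_def)
  show "card (pverts G) \<le> degree (domination_poly G)"
    using card_indep_less
    by (intro le_degree) (simp add: coeff_domination_poly proper_choose_def)
qed

lemma Suc_times_proper_choose_le:
  "Suc k * proper_choose (card N) k \<le> card (pverts G) choose k"
  unfolding proper_choose_def using Suc_times_binomial_le[OF small, of k] by simp

lemma proper_choose_le: "proper_choose (card N) k \<le> card (pverts G) choose k"
  using Suc_times_proper_choose_le[of k] by simp

lemma coeff_domination_poly_pos: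
  assumes "0 < k" "k \<le> card (pverts G)"
  shows "0 < coeff (domination_poly G) k"
proof -
  have "0 < card (pverts G) choose k" using assms by simp
  moreover have "2 * proper_choose (card N) k \<le> card (pverts G) choose k"
  proof -
    have "2 * proper_choose (card N) k \<le> Suc k * proper_choose (card N) k"
      using assms by (intro mult_right_mono) auto
    then show ?thesis using Suc_times_proper_choose_le[of k] by (rule le_trans)
  qed
  ultimately have "proper_choose (card N) k < card (pverts G) choose k" by linarith
  then show ?thesis by (simp add: coeff_domination_poly)
qed

lemma log_concave_domination_poly: "log_concave_poly (domination_poly G)"
  unfolding log_concave_poly_def degree_domination_poly
proof (intro allI impI)
  fix i
  assume i: "1 \<le> i \<and> i < card (pverts G)"
  then obtain k where k: "i = k + 1" by (metis Suc_eq_plus1 Suc_le_D One_nat_def)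
  let ?n = "card (pverts G)" and ?q = "card N"
  let ?a = "\<lambda>k. int (?n choose k)" and ?e = "\<lambda>k. int (proper_choose ?q k)"
  have "(?a k - ?e k) * (?a (k + 2) - ?e (k + 2)) \<le> (?a (k + 1) - ?e (k + 1))\<^sup>2"
  proof (rule log_concave_minus_small[where c = "int (k + 2)"])
    show "0 < ?a (k + 1)" using i k by simp
    show "?e k \<le> ?a k" "?e (k + 1) \<le> ?a (k + 1)" using proper_choose_le by simp_all
    have "proper_choose ?q (k + 1) * (?n choose k) \<le> proper_choose ?q k * (?n choose (k + 1))"
      using binomial_ratio_antimono[of ?q ?n k] card_indep_less by (simp add: proper_choose_def)
    then show "?e (k + 1) * ?a k \<le> ?e k * ?a (k + 1)"
      by (metis of_nat_mult of_nat_mono)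
    have "(k + 2) * proper_choose ?q (k + 1) \<le> ?n choose (k + 1)"
      using Suc_times_proper_choose_le[of "k + 1"] by simp
    then show "int (k + 2) * ?e (k + 1) \<le> ?a (k + 1)"
      by (metis of_nat_mult of_nat_mono)
    have "int ((k + 2) * ((?n choose k) * (?n choose (k + 2))))
        \<le> int ((k + 1) * (?n choose (k + 1))\<^sup>2)"
      using binomial_strong_log_concave by (rule of_nat_mono)
    then show "int (k + 2) * (?a k * ?a (k + 2)) \<le> (int (k + 2) - 1) * (?a (k + 1))\<^sup>2"
      by (simp only: of_nat_mult of_nat_power) simp
  qed simp_all
  then show "coeff (domination_poly G) (i - 1) * coeff (domination_poly G) (i + 1)
      \<le> (coeff (domination_poly G) i)\<^sup>2"
    by (simp add: k coeff_domination_poly)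
qed

lemma unimodal_domination_poly: "unimodal_poly (domination_poly G)"
proof (rule unimodal_poly_if_log_concave_poly[OF log_concave_domination_poly])
  show "0 \<le> coeff (domination_poly G) i" for i
    using proper_choose_le by (simp add: coeff_domination_poly)
  show "0 < coeff (domination_poly G) j"
    if "i \<le> j" "j \<le> degree (domination_poly G)" "0 < coeff (domination_poly G) i" for i j
    using that coeff_domination_poly_pos[of j]
    by (cases "j = 0") (auto simp: degree_domination_poly)
qed

end

section \<open>The co-maximal graph of a residue ring of prime power order\<close>

lemma (in cring) unit_comaximal:
  assumes a: "a \<in> Units R" and b: "b \<in> carrier R"
  shows "PIdl a <+>\<^bsub>R\<^esub> PIdl b = carrier R"
proof
  show "PIdl a <+>\<^bsub>R\<^esub> PIdl b \<subseteq> carrier R"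
    using a b by (auto simp: set_add_def' cgenideal_def)
  show "carrier R \<subseteq> PIdl a <+>\<^bsub>R\<^esub> PIdl b"
  proof
    fix x
    assume x: "x \<in> carrier R"
    have "x = (x \<otimes> inv a) \<otimes> a \<oplus> \<zero> \<otimes> b"
      using a b x by (simp add: m_assoc Units_closed)
    moreover have "x \<otimes> inv a \<in> carrier R" using a x by simp
    ultimately show "x \<in> PIdl a <+>\<^bsub>R\<^esub> PIdl b"
      unfolding set_add_def' cgenideal_def by blast
  qed
qed

text \<open>
  The multiples of a divisor \<open>d\<close> of the modulus form an ideal, which is proper unless \<open>d\<close> is a unit.
\<close>

lemma (in residues) common_divisor_not_comaximal:
  assumes "d dvd m" "\<not> is_unit d" "d dvd a" "d dvd b"
  shows "PIdl a <+>\<^bsub>R\<^esub> PIdl b \<noteq> carrier R"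
proof
  assume "PIdl a <+>\<^bsub>R\<^esub> PIdl b = carrier R"
  then have "\<one> \<in> PIdl a <+>\<^bsub>R\<^esub> PIdl b" by simp
  then obtain x y where "1 = (x * a mod m + y * b mod m) mod m"
    by (auto simp: set_add_def' cgenideal_def res_add_eq res_mult_eq res_one_eq)
  then have "[1 = x * a + y * b] (mod m)"
    using m_gt_one by (simp add: cong_def mod_simps)
  then have "[1 = x * a + y * b] (mod d)"
    using \<open>d dvd m\<close> by (rule cong_dvd_modulus)
  moreover have "d dvd x * a + y * b" using assms by simp
  ultimately have "is_unit d" using cong_dvd_iff by blast
  with \<open>\<not> is_unit d\<close> show False by simp
qed

lemma card_multiples_lessThan:
  fixes d c :: nat
  assumes "0 < d"
  shows "card {x \<in> {0..int (d * c) - 1}. int d dvd x} = c"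
proof -
  have "{x \<in> {0..int (d * c) - 1}. int d dvd x} = (\<lambda>i. int (d * i)) ` {..<c}"
  proof (intro equalityI subsetI)
    fix x
    assume "x \<in> {x \<in> {0..int (d * c) - 1}. int d dvd x}"
    then have "0 \<le> x" "x < int (d * c)" "int d dvd x" by auto
    then obtain y where y: "x = int (d * y)"
      by (metis dvdE nonneg_int_cases of_nat_dvd_iff)
    with \<open>x < int (d * c)\<close> have "d * y < d * c" by (simp only: of_nat_less_iff)
    with y show "x \<in> (\<lambda>i. int (d * i)) ` {..<c}" by simp
  next
    fix x
    assume "x \<in> (\<lambda>i. int (d * i)) ` {..<c}"
    then obtain i where i: "i < c" "x = int (d * i)" by auto
    then have "d * i < d * c" using assms by simp
    then have "x < int (d * c)" unfolding i(2) by (simp only: of_nat_less_iff)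
    then show "x \<in> {x \<in> {0..int (d * c) - 1}. int d dvd x}"
      using i by simp
  qed
  moreover have "inj_on (\<lambda>i. int (d * i)) {..<c}"
    using assms by (intro inj_onI) simp
  ultimately show ?thesis by (simp add: card_image)
qed

text \<open>
  Modulo a power of \<open>p\<close> the non-units are the multiples of \<open>p\<close>; they are one \<open>p\<close>-th of all residues,
  hence at most half of them.
\<close>

lemma small_complete_split_graph_comaximal_prime_power:
  fixes p m :: nat
  assumes p: "prime p" and m: "1 \<le> m"
  defines "R \<equiv> residue_ring (int (p ^ m))"
  shows "small_complete_split_graph (comaximal_graph R) {x \<in> carrier R. int p dvd x}"
proof -
  have p_gt: "1 < p" using p by (rule prime_gt_1_nat)
  then have "1 < int (p ^ m)" using m by (simp add: one_less_power)
  then interpret residues "int (p ^ m)" R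
    by (simp_all add: residues_def R_def)
  let ?G = "comaximal_graph R" and ?N = "{x \<in> carrier R. int p dvd x}"
  have verts: "pverts ?G = carrier R" by (simp add: comaximal_graph_def)
  have p_dvd: "int p dvd int (p ^ m)" using m by (simp add: dvd_power)
  have not_unit: "\<not> is_unit (int p)" using p_gt by simp
  have unit: "x \<in> Units R" if "x \<in> carrier R" "\<not> int p dvd x" for x
  proof -
    have "coprime (int p) x" using p that(2) by (intro prime_imp_coprime) auto
    then have "coprime x (int (p ^ m))" by (simp add: coprime_commute)
    moreover have "x \<noteq> 0" using that(2) by auto
    ultimately show ?thesis using that(1) by (auto simp: res_units_eq res_carrier_eq)
  qed
  have comaximal_iff: "PIdl\<^bsub>R\<^esub> a <+>\<^bsub>R\<^esub> PIdl\<^bsub>R\<^esub> b = carrier R \<longleftrightarrow> \<not> (a \<in> ?N \<and> b \<in> ?N)"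
    if ab: "a \<in> carrier R" "b \<in> carrier R" for a b
  proof (cases "int p dvd a")
    case True
    show ?thesis
    proof (cases "int p dvd b")
      case True
      then show ?thesis
        using \<open>int p dvd a\<close> ab common_divisor_not_comaximal[OF p_dvd not_unit] by simp
    next
      case False
      have "PIdl\<^bsub>R\<^esub> a <+>\<^bsub>R\<^esub> PIdl\<^bsub>R\<^esub> b = PIdl\<^bsub>R\<^esub> b <+>\<^bsub>R\<^esub> PIdl\<^bsub>R\<^esub> a"
        using ab by (intro set_add_comm) (auto simp: cgenideal_def)
      then show ?thesis using False ab unit unit_comaximal by simp
    qed
  next
    case False
    then show ?thesis using ab unit unit_comaximal by simp
  qed
  show ?thesis
  proof
    show "finite (pverts ?G)" by (simp add: verts)
    show "?N \<subseteq> pverts ?G" by (auto simp: verts)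
    have "0 \<in> ?N" using p_gt by (simp add: res_carrier_eq)
    then show "?N \<noteq> {}" by blast
    show "(a, b) \<in> parcs ?G \<longleftrightarrow>
        a \<in> pverts ?G \<and> b \<in> pverts ?G \<and> a \<noteq> b \<and> \<not> (a \<in> ?N \<and> b \<in> ?N)" for a b
      using comaximal_iff[of a b] by (auto simp: comaximal_graph_def)
    have power: "p ^ m = p * p ^ (m - 1)" using m by (cases m) auto
    have "card ?N = p ^ (m - 1)"
      unfolding res_carrier_eq power using p_gt by (intro card_multiples_lessThan) simp
    moreover have "card (pverts ?G) = p * p ^ (m - 1)"
      unfolding verts res_carrier_eq power[symmetric] by (simp flip: of_nat_power)
    ultimately show "2 * card ?N \<le> card (pverts ?G)"
      using p_gt by (simp add: Suc_leI)
  qed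
qed

theorem proposition3p1:
  fixes p m n :: nat
  assumes "prime p" and "m \<ge> 1" and "n = p ^ m"
  shows "log_concave_poly (domination_poly (comaximal_graph (residue_ring (int n)))) \<and>
         unimodal_poly (domination_poly (comaximal_graph (residue_ring (int n))))"
proof -
  interpret small_complete_split_graph "comaximal_graph (residue_ring (int n))"
    "{x \<in> carrier (residue_ring (int n)). int p dvd x}"
    unfolding \<open>n = p ^ m\<close>
    using assms(1,2) by (rule small_complete_split_graph_comaximal_prime_power)
  show ?thesis
    using log_concave_domination_poly unimodal_domination_poly by blast
qed

end
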